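(* Let $S$ and $R$ be finite dimensional real Hilbert spaces, let $O:S\to R$ be a linear operator, let $n_t\in\mathbb{N}$, $n_t\ge1$, and $\varepsilon_{\mathrm{testfail}}\in(0,1)$. Define the (random) norm estimator $$\Delta(O,n_t,\varepsilon_{\mathrm{testfail}}):=c_{\mathrm{est}}(n_t,\varepsilon_{\mathrm{testfail}})\max_{i\in\{1,\dots,n_t\}}\|O\,D_S^{-1}\,\underline r_i\|_R,$$ $$c_{\mathrm{est}}(n_t,\varepsilon_{\mathrm{testfail}}):=\Big(\sqrt{2\lambda_{\min}^{\underline{M}_S}}\;\mathrm{erf}^{-1}\big(\sqrt[n_t]{\varepsilon_{\mathrm{testfail}}}\big)\Big)^{-1},$$ where $\underline r_1,\dots,\underline r_{n_t}\in\mathbb{R}^{\dim S}$ are independent random normal vectors. Then $\Delta(O,n_t,\varepsilon_{\mathrm{testfail}})$ is an upper bound of the operator norm $\|O\|$ with probability at least $1-\varepsilon_{\mathrm{testfail}}$: $$\Pr\big(\|O\|\le\Delta(O,n_t,\varepsilon_{\mathrm{testfail}})\big)\ge1-\varepsilon_{\mathrm{testfail}} .$$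
   Context: A basis $\psi_1^S,\dots,\psi_{N_S}^S$ of $S$ is fixed ($N_S=\dim S$); $D_S:S\to\mathbb{R}^{N_S}$ maps an element to its coefficient vector; $\underline{M}_S$ with entries $(\psi_i^S,\psi_j^S)_S$ is the inner product matrix and $\lambda_{\min}^{\underline{M}_S}$ its smallest eigenvalue. A random normal vector is a random vector whose entries are i.i.d. standard normal random variables. $\mathrm{erf}(x)=\frac{2}{\sqrt\pi}\int_0^xe^{-t^2}\,dt$. $\|O\|=\sup_{\varphi\in S\setminus\{0\}}\|O\varphi\|_R/\|\varphi\|_S$. *)

theory Defs
  imports "HOL-Probability.Probability"
begin

(* A basis is a family indexed by a finite type 'n, so that N_S = CARD('n) and R^(N_S) is
   real ^ 'n. Index types are nonempty, hence S is not the zero space; for the zero space the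
   smallest eigenvalue below would not exist. *)
definition basis_family :: "('n::finite \<Rightarrow> 's::real_vector) \<Rightarrow> bool" where
  "basis_family \<psi> \<longleftrightarrow> inj \<psi> \<and> independent (range \<psi>) \<and> span (range \<psi>) = UNIV"

definition coeff_vec :: "('n::finite \<Rightarrow> 's::real_vector) \<Rightarrow> 's \<Rightarrow> real ^ 'n" where
  "coeff_vec \<psi> v = (\<chi> i. representation (range \<psi>) v (\<psi> i))"

definition inner_product_matrix :: "('n::finite \<Rightarrow> 's::real_inner) \<Rightarrow> real ^ 'n ^ 'n" where
  "inner_product_matrix \<psi> = (\<chi> i j. \<psi> i \<bullet> \<psi> j)"

definition eigenvalues :: "real ^ 'n ^ 'n \<Rightarrow> real set" where
  "eigenvalues A = {l. \<exists>v. v \<noteq> 0 \<and> A *v v = l *\<^sub>R v}"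

definition min_eigenvalue :: "real ^ 'n ^ 'n \<Rightarrow> real" where
  "min_eigenvalue A = Min (eigenvalues A)"

(* The interval integral is oriented, so this is the usual odd function on all of the reals. *)
definition erf :: "real \<Rightarrow> real" where
  "erf x = 2 / sqrt pi * (LBINT t=ereal 0..ereal x. exp (- t\<^sup>2))"

(* Only meaningful on the range ]-1, 1[ of erf; inv erf is unspecified elsewhere. *)
definition erf_inv :: "real \<Rightarrow> real" where
  "erf_inv = inv erf"

definition random_normal_vector :: "'a measure \<Rightarrow> ('a \<Rightarrow> real ^ 'n) \<Rightarrow> bool" where
  "random_normal_vector M X \<longleftrightarrow>
     prob_space.indep_vars M (\<lambda>_. borel) (\<lambda>j \<omega>. X \<omega> $ j) UNIV \<and>
     (\<forall>j. distributed M lborel (\<lambda>\<omega>. X \<omega> $ j) (\<lambda>x. ennreal (std_normal_density x)))"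

definition c_est :: "('n::finite \<Rightarrow> 's::real_inner) \<Rightarrow> nat \<Rightarrow> real \<Rightarrow> real" where
  "c_est \<psi> n \<epsilon> =
     inverse (sqrt (2 * min_eigenvalue (inner_product_matrix \<psi>)) * erf_inv (root n \<epsilon>))"

definition norm_estimator ::
    "('n::finite \<Rightarrow> 's::real_inner) \<Rightarrow> ('s \<Rightarrow> 'r::real_inner) \<Rightarrow> nat \<Rightarrow> real
      \<Rightarrow> (nat \<Rightarrow> 'a \<Rightarrow> real ^ 'n) \<Rightarrow> 'a \<Rightarrow> real" where
  "norm_estimator \<psi> Op n \<epsilon> r \<omega> =
     c_est \<psi> n \<epsilon> * Max ((\<lambda>i. norm (Op (inv (coeff_vec \<psi>) (r i \<omega>)))) ` {1..n})"

end

theory Submission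
  imports Defs
begin

text \<open>
  The estimate rests on replacing the operator by a rank-one minorant. Write \<open>T a\<close> for the
  element of \<open>S\<close> with coefficient vector \<open>a\<close>, and \<open>\<lambda>\<close> for the smallest eigenvalue of the
  inner product matrix. By compactness the operator norm is attained at a unit element \<open>T a\<close>.
  Taking the inner product with the direction of \<open>Op (T a)\<close> gives a vector \<open>b\<close> with
  \<open>\<bar>b \<bullet> x\<bar> \<le> norm (Op (T x))\<close> for all \<open>x\<close> and \<open>b \<bullet> a = norm (Op (T a)) \<ge> onorm Op\<close>.
  The Rayleigh bound \<open>\<lambda> * norm a ^ 2 \<le> norm (T a) ^ 2 = 1\<close> and the Cauchy-Schwarz inequality
  then yield \<open>onorm Op * sqrt \<lambda> \<le> norm b\<close> (lemma \<open>rank_one_lower_bound\<close>).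

  If \<open>b = 0\<close>, the operator vanishes and there is nothing to estimate. Otherwise, for a random normal
  vector \<open>X\<close>, the variable \<open>b \<bullet> X\<close> is centred normal with standard
  deviation \<open>norm b\<close>, so \<open>\<bar>b \<bullet> X\<bar>\<close> stays below \<open>sqrt 2 * norm b * y\<close> with probability \<open>erf y\<close>
  (lemma \<open>prob_normal_abs_less\<close>). If the estimator is smaller than \<open>onorm Op\<close>, this happens for
  every test vector with \<open>y\<close> chosen such that \<open>erf y\<close> is the \<open>n\<close>-th root of \<open>\<epsilon>\<close>; by
  independence the probability of that is at most \<open>\<epsilon>\<close>.
\<close>

section \<open>The error function\<close>

lemma erf_has_derivative:
  "(erf has_real_derivative 2 / sqrt pi * exp (- x\<^sup>2)) (at x)"
proof -
  \<comment> \<open>A compact interval that contains \<open>0\<close> and has \<open>x\<close> in its interior.\<close>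
  define a where "a = - \<bar>x\<bar> - 1"
  define b where "b = \<bar>x\<bar> + 1"
  have ab: "a \<le> 0" "0 \<le> b" "a < x" "x < b" by (auto simp: a_def b_def)
  have "((\<lambda>u. LBINT y=ereal 0..ereal u. exp (- y\<^sup>2)) has_vector_derivative exp (- x\<^sup>2))
      (at x within {a..b})"
    using ab by (intro interval_integral_FTC2[of a 0 b "\<lambda>t. exp (- t\<^sup>2) :: real" x])
      (auto intro!: continuous_intros)
  moreover have "at x within {a..b} = at x" using ab by (simp add: at_within_Icc_at)
  ultimately have "((\<lambda>u. LBINT y=ereal 0..ereal u. exp (- y\<^sup>2)) has_real_derivative exp (- x\<^sup>2)) (at x)"
    by (simp add: has_real_derivative_iff_has_vector_derivative)
  from DERIV_cmult[OF this, of "2 / sqrt pi"] show ?thesis by (simp add: erf_def[abs_def])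
qed

lemma erf_strict_mono: "strict_mono erf"
proof (rule strict_monoI)
  fix x y :: real assume "x < y"
  then show "erf x < erf y"
  proof (rule DERIV_pos_imp_increasing)
    fix z
    have "0 < 2 / sqrt pi * exp (- z\<^sup>2)" by simp
    with erf_has_derivative show "\<exists>D. (erf has_real_derivative D) (at z) \<and> 0 < D" by blast
  qed
qed

lemma erf_0 [simp]: "erf 0 = 0"
  by (simp add: erf_def)

lemma erf_inv_erf [simp]: "erf_inv (erf x) = x"
  unfolding erf_inv_def using erf_strict_mono by (simp add: strict_mono_imp_inj_on inv_f_f)

lemma erf_nonneg_eq:
  assumes "0 \<le> x"
  shows "erf x = 2 / sqrt pi * (LBINT t. indicator {0..x} t *\<^sub>R exp (- t\<^sup>2))"
  using assms by (simp add: erf_def interval_integral_Icc set_lebesgue_integral_def)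

lemma erf_tendsto_1: "(erf \<longlongrightarrow> 1) at_top"
proof -
  let ?f = "\<lambda>t::real. indicator {0..} t *\<^sub>R exp (- t\<^sup>2) :: real"
  have "((\<lambda>x. LBINT t. indicator {..x} t *\<^sub>R ?f t) \<longlongrightarrow> (LBINT t. ?f t)) at_top"
    using gaussian_moment_0 by (intro tendsto_integral_at_top) (auto intro: integrable.intros)
  then have "((\<lambda>x. 2 / sqrt pi * (LBINT t. indicator {..x} t *\<^sub>R ?f t)) \<longlongrightarrow> 2 / sqrt pi * (sqrt pi / 2)) at_top"
    unfolding has_bochner_integral_integral_eq[OF gaussian_moment_0]
    by (intro tendsto_mult tendsto_const)
  then have "((\<lambda>x. 2 / sqrt pi * (LBINT t. indicator {..x} t *\<^sub>R ?f t)) \<longlongrightarrow> 1) at_top" by simp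
  moreover have "eventually (\<lambda>x. 2 / sqrt pi * (LBINT t. indicator {..x} t *\<^sub>R ?f t) = erf x) at_top"
  proof (rule eventually_mono[OF eventually_ge_at_top[of 0]])
    fix x :: real assume "0 \<le> x"
    have "(\<lambda>t. indicator {..x} t *\<^sub>R ?f t) = (\<lambda>t. indicator {0..x} t *\<^sub>R exp (- t\<^sup>2))"
      by (auto simp: indicator_def)
    then show "2 / sqrt pi * (LBINT t. indicator {..x} t *\<^sub>R ?f t) = erf x"
      by (simp only: erf_nonneg_eq[OF \<open>0 \<le> x\<close>])
  qed
  ultimately show ?thesis by (rule Lim_transform_eventually)
qed

lemma erf_inv_properties:
  assumes "0 < p" "p < 1"
  shows "erf (erf_inv p) = p" and "0 < erf_inv p"
proof -
  have "eventually (\<lambda>x. p < erf x) at_top"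
    using erf_tendsto_1 \<open>p < 1\<close> by (rule order_tendstoD)
  then obtain b where b: "0 \<le> b" "p < erf b"
    using eventually_happens'[OF trivial_limit_at_top_linorder
        eventually_conj[OF eventually_ge_at_top[of 0]]] by blast
  have "\<exists>y. 0 \<le> y \<and> y \<le> b \<and> erf y = p"
    using assms b by (intro IVT) (auto intro: DERIV_isCont[OF erf_has_derivative])
  then obtain y where y: "0 \<le> y" "erf y = p" by blast
  then have "y \<noteq> 0" using assms by auto
  with y show "erf (erf_inv p) = p" "0 < erf_inv p" by (auto simp flip: y(2))
qed

section \<open>Normal random variables and random normal vectors\<close>

text \<open>Dividing \<open>X\<close> by \<open>sqrt 2 * \<sigma>\<close> produces the density \<open>exp (- x\<^sup>2) / sqrt pi\<close>, whose integral over
  a symmetric interval is the error function.\<close>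

lemma (in prob_space) prob_normal_abs_less:
  assumes "distributed M lborel X (normal_density 0 \<sigma>)" "0 < \<sigma>" "0 \<le> y"
  shows "prob {\<omega> \<in> space M. \<bar>X \<omega>\<bar> < sqrt 2 * \<sigma> * y} = erf y"
proof -
  define \<tau> :: real where "\<tau> = 1 / sqrt 2"
  define W where "W = (\<lambda>\<omega>. 0 + 1 / (sqrt 2 * \<sigma>) * X \<omega>)"
  have "distributed M lborel W (normal_density (0 + 1 / (sqrt 2 * \<sigma>) * 0) (\<bar>1 / (sqrt 2 * \<sigma>)\<bar> * \<sigma>))"
    unfolding W_def using assms by (intro normal_density_affine) auto
  moreover have "\<bar>1 / (sqrt 2 * \<sigma>)\<bar> * \<sigma> = \<tau>" using assms by (simp add: \<tau>_def)
  ultimately have W: "distributed M lborel W (normal_density 0 \<tau>)" by simp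
  have dens: "normal_density 0 \<tau> x = exp (- x\<^sup>2) / sqrt pi" for x
    by (simp add: normal_density_def \<tau>_def power_divide)
  let ?g = "\<lambda>x. indicator {-y..y} x * exp (- x\<^sup>2) :: real"
  have int0: "has_bochner_integral lborel (\<lambda>x. indicator {0..} x *\<^sub>R ?g x) (sqrt pi / 2 * erf y)"
  proof -
    have "set_integrable lborel {0..y} (\<lambda>t. exp (- t\<^sup>2) :: real)"
      by (intro borel_integrable_atLeastAtMost') (auto intro!: continuous_intros)
    moreover have "(LBINT t. indicator {0..y} t *\<^sub>R exp (- t\<^sup>2) :: real) = sqrt pi / 2 * erf y"
      by (simp add: erf_nonneg_eq[OF \<open>0 \<le> y\<close>])
    moreover have "(\<lambda>x. indicator {0..} x *\<^sub>R ?g x) = (\<lambda>x. indicator {0..y} x *\<^sub>R exp (- x\<^sup>2))"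
      using \<open>0 \<le> y\<close> by (auto simp: indicator_def)
    ultimately show ?thesis by (simp only: has_bochner_integral_iff set_integrable_def)
  qed
  have "has_bochner_integral lborel ?g (2 *\<^sub>R (sqrt pi / 2 * erf y))"
    by (rule has_bochner_integral_even_function[OF int0]) (auto simp: indicator_def)
  then have "has_bochner_integral lborel (\<lambda>x. ?g x / sqrt pi) (erf y)"
    using has_bochner_integral_divide[of lborel ?g "2 *\<^sub>R (sqrt pi / 2 * erf y)" "sqrt pi"] by simp
  then have "(\<integral>\<^sup>+x. ennreal (?g x / sqrt pi) \<partial>lborel) = ennreal (erf y)"
    by (subst nn_integral_eq_integral) (auto simp: has_bochner_integral_iff)
  moreover have "(\<integral>\<^sup>+x. ennreal (normal_density 0 \<tau> x) * indicator {-y<..<y} x \<partial>lborel)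
      = (\<integral>\<^sup>+x. ennreal (?g x / sqrt pi) \<partial>lborel)"
    by (intro nn_integral_cong_AE AE_I[where N="{-y, y}"])
       (auto simp: dens indicator_def emeasure_lborel_countable)
  ultimately have "emeasure M (W -` {-y<..<y} \<inter> space M) = ennreal (erf y)"
    by (subst distributed_emeasure[OF W]) auto
  moreover have "W -` {-y<..<y} \<inter> space M = {\<omega> \<in> space M. \<bar>X \<omega>\<bar> < sqrt 2 * \<sigma> * y}"
    using \<open>0 < \<sigma>\<close> by (auto simp: W_def abs_less_iff field_simps)
  moreover have "0 \<le> erf y"
    using \<open>0 \<le> y\<close> strict_mono_less_eq[OF erf_strict_mono, of 0 y] by simp
  ultimately show ?thesis by (simp add: measure_def)
qed

lemma (in prob_space) inner_random_normal_vector_distributed: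
  fixes X :: "'a \<Rightarrow> real ^ 'n" and b :: "real ^ 'n"
  assumes X: "random_normal_vector M X" and b: "b \<noteq> 0"
  shows "distributed M lborel (\<lambda>\<omega>. b \<bullet> X \<omega>) (normal_density 0 (norm b))"
proof -
  \<comment> \<open>Vanishing coefficients are dropped, since they would give degenerate normal summands.\<close>
  define J where "J = {j. b $ j \<noteq> 0}"
  have J: "finite J" "J \<noteq> {}" using b by (auto simp: J_def vec_eq_iff)
  have ind: "indep_vars (\<lambda>_. borel) (\<lambda>j \<omega>. X \<omega> $ j) UNIV"
    and std: "\<And>j. distributed M lborel (\<lambda>\<omega>. X \<omega> $ j) (\<lambda>x. ennreal (std_normal_density x))"
    using X by (auto simp: random_normal_vector_def)
  have "indep_vars (\<lambda>_. borel) (\<lambda>j \<omega>. b $ j * X \<omega> $ j) J"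
    by (rule indep_vars_compose2[where Y="\<lambda>j x. b $ j * x", OF indep_vars_subset[OF ind]]) auto
  moreover have "distributed M lborel (\<lambda>\<omega>. b $ j * X \<omega> $ j) (normal_density 0 \<bar>b $ j\<bar>)"
    if "j \<in> J" for j
    using normal_density_affine[OF std, of "b $ j" 0 j] that by (simp add: J_def)
  ultimately have "distributed M lborel (\<lambda>\<omega>. \<Sum>j\<in>J. b $ j * X \<omega> $ j)
      (normal_density (\<Sum>j\<in>J. 0) (sqrt (\<Sum>j\<in>J. \<bar>b $ j\<bar>\<^sup>2)))"
    using J by (intro sum_indep_normal) (auto simp: J_def)
  moreover have "(\<lambda>\<omega>. \<Sum>j\<in>J. b $ j * X \<omega> $ j) = (\<lambda>\<omega>. b \<bullet> X \<omega>)"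
    by (auto simp: inner_vec_def J_def intro!: sum.mono_neutral_left ext)
  moreover have "sqrt (\<Sum>j\<in>J. \<bar>b $ j\<bar>\<^sup>2) = norm b"
    by (auto simp: norm_vec_def L2_set_def J_def intro!: sum.mono_neutral_left)
  ultimately show ?thesis by simp
qed

section \<open>The coordinate isomorphism and the inner product matrix\<close>

text \<open>The inverse of the coefficient map is the linear combination map. All later arguments work
  with this explicit form instead of \<open>inv\<close>.\<close>

lemma coeff_vec_inverse:
  fixes \<psi> :: "'n::finite \<Rightarrow> 's::real_vector"
  assumes "basis_family \<psi>"
  shows "inv (coeff_vec \<psi>) = (\<lambda>a. \<Sum>i\<in>UNIV. (a $ i) *\<^sub>R \<psi> i)"
    and "inj (\<lambda>a::real^'n. \<Sum>i\<in>UNIV. (a $ i) *\<^sub>R \<psi> i)"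
    and "surj (\<lambda>a::real^'n. \<Sum>i\<in>UNIV. (a $ i) *\<^sub>R \<psi> i)"
proof -
  have inj: "inj \<psi>" and ind: "independent (range \<psi>)" and sp: "span (range \<psi>) = UNIV"
    using assms by (auto simp: basis_family_def)
  let ?T = "\<lambda>a::real^'n. \<Sum>i\<in>UNIV. (a $ i) *\<^sub>R \<psi> i"
  have TC: "?T (coeff_vec \<psi> v) = v" for v
  proof -
    have "?T (coeff_vec \<psi> v) = (\<Sum>b\<in>range \<psi>. representation (range \<psi>) v b *\<^sub>R b)"
      using inj by (simp add: coeff_vec_def sum.reindex)
    also have "\<dots> = v"
      by (rule real_vector.sum_representation_eq[OF ind]) (auto simp: sp)
    finally show ?thesis .
  qed
  have CT: "coeff_vec \<psi> (?T a) = a" for a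
  proof -
    have "representation (range \<psi>) (?T a) (\<psi> j) = a $ j" for j
    proof -
      have "representation (range \<psi>) (?T a) (\<psi> j)
          = (\<Sum>i\<in>UNIV. representation (range \<psi>) ((a $ i) *\<^sub>R \<psi> i) (\<psi> j))"
        by (subst real_vector.representation_sum[OF ind]) (auto simp: sp)
      also have "\<dots> = (\<Sum>i\<in>UNIV. if i = j then a $ i else 0)"
        using inj by (intro sum.cong refl)
          (auto simp: real_vector.representation_scale[OF ind] sp
                      real_vector.representation_basis[OF ind] inj_eq)
      also have "\<dots> = a $ j" by simp
      finally show ?thesis .
    qed
    then show ?thesis by (simp add: coeff_vec_def vec_eq_iff)
  qed
  show "inv (coeff_vec \<psi>) = ?T"
    by (rule inv_equality) (auto simp: TC CT)
  show "inj ?T" using CT by (rule inj_on_inverseI)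
  show "surj ?T" by (rule surjI) (rule TC)
qed

lemma linear_combination_linear:
  fixes \<psi> :: "'n::finite \<Rightarrow> 's::real_vector"
  shows "linear (\<lambda>a::real^'n. \<Sum>i\<in>UNIV. (a $ i) *\<^sub>R \<psi> i)"
  by (rule linearI) (simp_all add: scaleR_left_distrib sum.distrib scaleR_sum_right)

lemma inner_product_matrix_mult:
  fixes \<psi> :: "'n::finite \<Rightarrow> 's::real_inner"
  shows "b \<bullet> (inner_product_matrix \<psi> *v a)
    = (\<Sum>i\<in>UNIV. (b $ i) *\<^sub>R \<psi> i) \<bullet> (\<Sum>i\<in>UNIV. (a $ i) *\<^sub>R \<psi> i)"
proof -
  have "b \<bullet> (inner_product_matrix \<psi> *v a)
      = (\<Sum>i\<in>UNIV. \<Sum>j\<in>UNIV. b $ i * (a $ j * (\<psi> i \<bullet> \<psi> j)))"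
    by (simp add: inner_product_matrix_def inner_vec_def matrix_vector_mult_def
        sum_distrib_left mult_ac)
  then show ?thesis by (simp add: inner_sum_left inner_sum_right) (subst sum.swap, simp add: sum_distrib_left mult_ac)
qed

section \<open>The smallest eigenvalue of a symmetric matrix\<close>

text \<open>Eigenvectors for distinct eigenvalues are orthogonal. Finiteness is needed because the
  smallest eigenvalue is a minimum over the set of eigenvalues.\<close>

lemma finite_eigenvalues_symmetric:
  fixes A :: "real ^ 'n ^ 'n"
  assumes sym: "\<And>x y. x \<bullet> (A *v y) = y \<bullet> (A *v x)"
  shows "finite (eigenvalues A)"
proof -
  have "\<forall>l\<in>eigenvalues A. \<exists>v. v \<noteq> 0 \<and> A *v v = l *\<^sub>R v"
    by (auto simp: eigenvalues_def)
  then obtain V where V: "\<And>l. l \<in> eigenvalues A \<Longrightarrow> V l \<noteq> 0 \<and> A *v V l = l *\<^sub>R V l"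
    by metis
  have orth: "V l \<bullet> V m = 0" if "l \<in> eigenvalues A" "m \<in> eigenvalues A" "l \<noteq> m" for l m
  proof -
    have "m * (V l \<bullet> V m) = l * (V l \<bullet> V m)"
      using sym[of "V l" "V m"] V[OF that(1)] V[OF that(2)] by (simp add: inner_commute)
    with \<open>l \<noteq> m\<close> show ?thesis by simp
  qed
  have "pairwise orthogonal (V ` eigenvalues A)"
    unfolding pairwise_def orthogonal_def using orth by blast
  then have "finite (V ` eigenvalues A)" by (rule pairwise_orthogonal_imp_finite)
  moreover have "inj_on V (eigenvalues A)"
  proof (rule inj_onI, rule ccontr)
    fix l m assume lm: "l \<in> eigenvalues A" "m \<in> eigenvalues A" "V l = V m" "l \<noteq> m"
    then show False using orth[OF lm(1,2,4)] V[OF lm(1)] by simp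
  qed
  ultimately show ?thesis by (rule finite_imageD)
qed

text \<open>A minimizer of the Rayleigh quotient on the unit sphere is an eigenvector.\<close>

lemma Rayleigh_minimum_eigenvalue:
  fixes A :: "real ^ 'n ^ 'n"
  assumes sym: "\<And>x y. x \<bullet> (A *v y) = y \<bullet> (A *v x)"
  obtains \<rho> where "\<rho> \<in> eigenvalues A" "\<And>x. \<rho> * (norm x)\<^sup>2 \<le> x \<bullet> (A *v x)"
proof -
  let ?S = "sphere (0 :: real ^ 'n) 1"
  have "continuous_on ?S (\<lambda>x. x \<bullet> (A *v x))"
    by (intro continuous_on_inner continuous_on_id linear_continuous_on
        matrix_vector_mul_bounded_linear)
  moreover have "?S \<noteq> {}" by simp
  ultimately obtain x0 where x0: "norm x0 = 1"
    and min: "\<And>x. norm x = 1 \<Longrightarrow> x0 \<bullet> (A *v x0) \<le> x \<bullet> (A *v x)"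
    using continuous_attains_inf[of ?S "\<lambda>x. x \<bullet> (A *v x)"] by auto
  define \<rho> where "\<rho> = x0 \<bullet> (A *v x0)"
  have ray: "\<rho> * (norm x)\<^sup>2 \<le> x \<bullet> (A *v x)" for x
  proof (cases "x = 0")
    case False
    have "\<rho> \<le> (x /\<^sub>R norm x) \<bullet> (A *v (x /\<^sub>R norm x))"
      unfolding \<rho>_def using False by (intro min) simp
    also have "\<dots> = (x \<bullet> (A *v x)) / (norm x)\<^sup>2"
      by (simp add: matrix_vector_mult_scaleR power2_eq_square field_simps)
    finally show ?thesis using False by (simp add: field_simps)
  qed simp
  define z where "z = A *v x0 - \<rho> *\<^sub>R x0"
  define q where "q = z \<bullet> (A *v z) - \<rho> * (norm z)\<^sup>2"
  \<comment> \<open>The quadratic form \<open>x \<bullet> A x - \<rho> |x|\<^sup>2\<close> is nonnegative and vanishes at \<open>x0\<close>;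
    its first-order variation in the direction of the residual \<open>z\<close> must be zero.\<close>
  have var: "0 \<le> 2 * t * (z \<bullet> z) + t\<^sup>2 * q" for t
  proof -
    have "0 \<le> (x0 + t *\<^sub>R z) \<bullet> (A *v (x0 + t *\<^sub>R z)) - \<rho> * (norm (x0 + t *\<^sub>R z))\<^sup>2"
      using ray by simp
    also have "\<dots> = (x0 \<bullet> (A *v x0) - \<rho> * (norm x0)\<^sup>2)
        + 2 * t * (z \<bullet> (A *v x0 - \<rho> *\<^sub>R x0)) + t\<^sup>2 * q"
    proof -
      have "(norm (x0 + t *\<^sub>R z))\<^sup>2 = (norm x0)\<^sup>2 + 2 * t * (z \<bullet> x0) + t\<^sup>2 * (norm z)\<^sup>2"
        unfolding power2_norm_eq_inner
        by (simp add: inner_add_left inner_add_right inner_commute power2_eq_square)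
      moreover have "(x0 + t *\<^sub>R z) \<bullet> (A *v (x0 + t *\<^sub>R z))
          = x0 \<bullet> (A *v x0) + 2 * t * (z \<bullet> (A *v x0)) + t\<^sup>2 * (z \<bullet> (A *v z))"
        using sym[of x0 z]
        by (simp add: matrix_vector_mult_scaleR matrix_vector_right_distrib
            inner_add_left inner_add_right power2_eq_square distrib_left)
      ultimately show ?thesis by (simp add: q_def inner_diff_right algebra_simps)
    qed
    also have "\<dots> = 2 * t * (z \<bullet> z) + t\<^sup>2 * q"
      by (simp add: x0 \<rho>_def z_def)
    finally show ?thesis .
  qed
  have "z = 0"
  proof (rule ccontr)
    assume "z \<noteq> 0"
    then have zz: "z \<bullet> z > 0" by simp
    have q: "q \<ge> 0" unfolding q_def using ray[of z] by simp
    \<comment> \<open>The parabola in \<open>var\<close> has slope \<open>2 * (z \<bullet> z)\<close> at \<open>0\<close>, so a small negative \<open>t\<close> contradicts it;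
      the summand \<open>1\<close> in the denominator covers the case \<open>q = 0\<close>.\<close>
    define t where "t = - (z \<bullet> z) / (q + 1)"
    have "t * (q + 1) = - (z \<bullet> z)" using q by (simp add: t_def)
    then have "t * q = - (z \<bullet> z) - t" by (simp add: algebra_simps)
    have t: "t < 0" using zz q by (simp add: t_def divide_neg_pos)
    have "2 * t * (z \<bullet> z) + t\<^sup>2 * q = t * (2 * (z \<bullet> z) + t * q)"
      by (simp add: power2_eq_square algebra_simps)
    also have "\<dots> = t * (z \<bullet> z - t)" by (simp add: \<open>t * q = _\<close>)
    also have "\<dots> < 0" using t zz by (intro mult_neg_pos) linarith+
    finally show False using var[of t] by simp
  qed
  then have "A *v x0 = \<rho> *\<^sub>R x0" by (simp add: z_def)
  moreover have "x0 \<noteq> 0" using x0 by auto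
  ultimately have "\<rho> \<in> eigenvalues A" by (auto simp: eigenvalues_def)
  with ray show thesis by (rule that[rotated])
qed

text \<open>The second part is the quantitative form of the injectivity of the coordinate map: an element
  of norm one has a coefficient vector of norm at most \<open>1 / sqrt l\<close>.\<close>

lemma min_eigenvalue_gram:
  fixes \<psi> :: "'n::finite \<Rightarrow> 's::real_inner"
  assumes "basis_family \<psi>"
  defines "l \<equiv> min_eigenvalue (inner_product_matrix \<psi>)"
  shows "l > 0"
    and "l * (norm a)\<^sup>2 \<le> (norm (\<Sum>i\<in>UNIV. (a $ i) *\<^sub>R \<psi> i))\<^sup>2"
proof -
  let ?T = "\<lambda>a::real^'n. \<Sum>i\<in>UNIV. (a $ i) *\<^sub>R \<psi> i"
  let ?A = "inner_product_matrix \<psi>"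
  have sym: "x \<bullet> (?A *v y) = y \<bullet> (?A *v x)" for x y
    by (simp only: inner_product_matrix_mult) (rule inner_commute)
  have fin: "finite (eigenvalues ?A)" by (rule finite_eigenvalues_symmetric[OF sym])
  obtain \<rho> where \<rho>: "\<rho> \<in> eigenvalues ?A" "\<And>x. \<rho> * (norm x)\<^sup>2 \<le> x \<bullet> (?A *v x)"
    using Rayleigh_minimum_eigenvalue[OF sym] by blast
  have le: "l \<le> \<rho>" unfolding l_def min_eigenvalue_def using fin \<rho>(1) by (rule Min_le)
  have "l \<in> eigenvalues ?A" unfolding l_def min_eigenvalue_def
    using fin \<rho>(1) by (intro Min_in) auto
  then obtain v where v: "v \<noteq> 0" "?A *v v = l *\<^sub>R v" by (auto simp: eigenvalues_def)
  have "?T v \<noteq> 0"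
  proof
    assume "?T v = 0"
    then have "?T v = ?T 0" by simp
    with coeff_vec_inverse(2)[OF assms(1)] have "v = 0" by (rule injD)
    with v(1) show False ..
  qed
  then have "0 < v \<bullet> (?A *v v)" by (simp only: inner_product_matrix_mult) simp
  also have "\<dots> = l * (v \<bullet> v)" by (simp add: v)
  finally have "0 < l * (v \<bullet> v)" .
  moreover have "0 < v \<bullet> v" using v(1) by simp
  ultimately show "l > 0" by (rule zero_less_mult_pos2)
  have "l * (norm a)\<^sup>2 \<le> \<rho> * (norm a)\<^sup>2" using le by (intro mult_right_mono) auto
  also have "\<dots> \<le> a \<bullet> (?A *v a)" by (rule \<rho>(2))
  also have "\<dots> = (norm (?T a))\<^sup>2"
    by (simp only: inner_product_matrix_mult power2_norm_eq_inner)
  finally show "l * (norm a)\<^sup>2 \<le> (norm (?T a))\<^sup>2" .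
qed

section \<open>A rank-one minorant of the operator\<close>

text \<open>\<open>S\<close> is only known to be an inner product space with a finite basis, so the compactness argument
  is carried out on the preimage of its unit sphere under the coordinate map.\<close>

lemma norm_attaining_direction:
  fixes \<psi> :: "'n::finite \<Rightarrow> 's::real_inner" and Op :: "'s \<Rightarrow> 'r::real_inner"
  assumes \<psi>: "basis_family \<psi>" and "linear Op"
  obtains a :: "real ^ 'n"
  where "norm (\<Sum>i\<in>UNIV. (a $ i) *\<^sub>R \<psi> i) = 1"
    and "onorm Op \<le> norm (Op (\<Sum>i\<in>UNIV. (a $ i) *\<^sub>R \<psi> i))"
proof -
  let ?T = "\<lambda>a::real^'n. \<Sum>i\<in>UNIV. (a $ i) *\<^sub>R \<psi> i"
  let ?l = "min_eigenvalue (inner_product_matrix \<psi>)"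
  interpret Op: linear Op by fact
  have T: "linear ?T" by (rule linear_combination_linear)
  have contT: "continuous_on S ?T" and contOp: "continuous_on S (\<lambda>a. Op (?T a))" for S
    using T linear_compose[OF T \<open>linear Op\<close>]
    by (simp_all only: linear_conv_bounded_linear linear_continuous_on o_def)
  define K where "K = {a. norm (?T a) = 1}"
  have "closed K" unfolding K_def
    by (intro closed_Collect_eq continuous_on_norm contT continuous_on_const)
  moreover have "bounded K"
  proof (rule boundedI)
    fix a assume "a \<in> K"
    then have "?l * (norm a)\<^sup>2 \<le> 1" using min_eigenvalue_gram(2)[OF \<psi>, of a] by (simp add: K_def)
    then have "(norm a)\<^sup>2 \<le> 1 / ?l" using min_eigenvalue_gram(1)[OF \<psi>] by (simp add: field_simps)
    then show "norm a \<le> sqrt (1 / ?l)" by (rule real_le_rsqrt)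
  qed
  ultimately have "compact K" by (simp add: compact_eq_bounded_closed)
  moreover have normalize: "\<exists>a\<in>K. ?T a = s /\<^sub>R norm s" if s: "s \<noteq> 0" for s
  proof -
    obtain a where "s /\<^sub>R norm s = ?T a" using coeff_vec_inverse(3)[OF \<psi>] by (rule surjE)
    moreover have "norm (s /\<^sub>R norm s) = 1" using s by simp
    ultimately show ?thesis by (auto simp: K_def intro!: bexI[of _ a])
  qed
  moreover have "K \<noteq> {}"
  proof -
    have "0 \<notin> range \<psi>"
      using \<psi> real_vector.dependent_zero[of "range \<psi>"] by (auto simp: basis_family_def)
    then have "\<psi> undefined \<noteq> 0" by (metis rangeI)
    from normalize[OF this] show ?thesis by auto
  qed
  ultimately obtain a where a: "a \<in> K" and max: "\<And>x. x \<in> K \<Longrightarrow> norm (Op (?T x)) \<le> norm (Op (?T a))"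
    using continuous_attains_sup[OF _ _ continuous_on_norm[OF contOp], of K] by metis
  have "onorm Op \<le> norm (Op (?T a))"
  proof (rule onorm_bound)
    fix s
    show "norm (Op s) \<le> norm (Op (?T a)) * norm s"
    proof (cases "s = 0")
      case False
      then obtain x where x: "x \<in> K" "?T x = s /\<^sub>R norm s" using normalize[OF False] by (elim bexE)
      have "norm (Op (s /\<^sub>R norm s)) \<le> norm (Op (?T a))" using max[OF x(1)] by (simp only: x(2))
      then show ?thesis using False by (simp add: Op.scaleR field_simps)
    qed (simp add: Op.zero)
  qed simp
  with a show thesis by (intro that) (auto simp: K_def)
qed

text \<open>The functional \<open>x \<mapsto> b \<bullet> x\<close> is the component of \<open>Op (T x)\<close> in the direction of a value of
  \<open>Op\<close> of maximal norm on the unit sphere. When \<open>Op = 0\<close>, that direction is \<open>sgn 0 = 0\<close> and \<open>b = 0\<close>.\<close>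

lemma rank_one_lower_bound:
  fixes \<psi> :: "'n::finite \<Rightarrow> 's::real_inner" and Op :: "'s \<Rightarrow> 'r::real_inner"
  assumes \<psi>: "basis_family \<psi>" and "linear Op"
  obtains b :: "real ^ 'n"
  where "onorm Op * sqrt (min_eigenvalue (inner_product_matrix \<psi>)) \<le> norm b"
    and "\<And>x. \<bar>b \<bullet> x\<bar> \<le> norm (Op (\<Sum>i\<in>UNIV. (x $ i) *\<^sub>R \<psi> i))"
proof -
  let ?T = "\<lambda>a::real^'n. \<Sum>i\<in>UNIV. (a $ i) *\<^sub>R \<psi> i"
  let ?l = "min_eigenvalue (inner_product_matrix \<psi>)"
  interpret Op: linear Op by fact
  obtain a where a: "norm (?T a) = 1" "onorm Op \<le> norm (Op (?T a))"
    using norm_attaining_direction[OF assms] .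
  define w where "w = sgn (Op (?T a))"
  define b :: "real ^ 'n" where "b = (\<chi> i. Op (\<psi> i) \<bullet> w)"
  have b: "b \<bullet> x = Op (?T x) \<bullet> w" for x
    by (simp add: b_def inner_vec_def Op.sum Op.scaleR inner_sum_left mult.commute)
  have "norm (Op (?T a)) = b \<bullet> a"
    by (cases "Op (?T a) = 0")
       (simp_all add: b w_def sgn_div_norm dot_square_norm power2_eq_square)
  also have "\<dots> \<le> norm b * norm a" by (rule norm_cauchy_schwarz)
  finally have le: "onorm Op \<le> norm b * norm a" using a(2) by simp
  have "?l * (norm a)\<^sup>2 \<le> 1" using min_eigenvalue_gram(2)[OF \<psi>, of a] a(1) by simp
  then have "sqrt (?l * (norm a)\<^sup>2) \<le> 1" by simp
  then have la: "norm a * sqrt ?l \<le> 1" by (simp add: real_sqrt_mult mult.commute)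
  have "onorm Op * sqrt ?l \<le> norm b * norm a * sqrt ?l"
    using le min_eigenvalue_gram(1)[OF \<psi>] by (intro mult_right_mono) auto
  also have "\<dots> = norm b * (norm a * sqrt ?l)" by simp
  also have "\<dots> \<le> norm b" using mult_left_mono[OF la, of "norm b"] by simp
  finally have "onorm Op * sqrt ?l \<le> norm b" .
  moreover have "\<bar>b \<bullet> x\<bar> \<le> norm (Op (?T x))" for x
  proof -
    have "\<bar>b \<bullet> x\<bar> \<le> norm (Op (?T x)) * norm w" unfolding b by (rule Cauchy_Schwarz_ineq2)
    also have "\<dots> \<le> norm (Op (?T x)) * 1"
      by (intro mult_left_mono) (auto simp: w_def norm_sgn)
    finally show ?thesis by simp
  qed
  ultimately show thesis by (rule that)
qed

section \<open>The norm estimator\<close>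

theorem proposition5p2p3:
  fixes M :: "'a measure"
    and \<psi> :: "'n::finite \<Rightarrow> 's::real_inner"
    and Op :: "'s \<Rightarrow> 'r::real_inner"
    and r :: "nat \<Rightarrow> 'a \<Rightarrow> real ^ 'n"
    and n\<^sub>t :: nat
    and \<epsilon> :: real
  assumes "basis_family \<psi>"
    and "\<exists>B :: 'r set. finite B \<and> span B = UNIV"
    and "linear Op"
    and "n\<^sub>t \<ge> 1"
    and "0 < \<epsilon>" and "\<epsilon> < 1"
    and "prob_space M"
    and "\<And>i. i \<in> {1..n\<^sub>t} \<Longrightarrow> random_normal_vector M (r i)"
    and "prob_space.indep_vars M (\<lambda>_. borel) r {1..n\<^sub>t}"
  shows "measure M {\<omega> \<in> space M. onorm Op \<le> norm_estimator \<psi> Op n\<^sub>t \<epsilon> r \<omega>} \<ge> 1 - \<epsilon>"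
proof -
  interpret prob_space M by fact
  let ?T = "\<lambda>a::real^'n. \<Sum>i\<in>UNIV. (a $ i) *\<^sub>R \<psi> i"
  let ?l = "min_eigenvalue (inner_product_matrix \<psi>)"
  let ?I = "{1..n\<^sub>t}"
  have I: "finite ?I" "?I \<noteq> {}" using \<open>n\<^sub>t \<ge> 1\<close> by auto
  define y where "y = erf_inv (root n\<^sub>t \<epsilon>)"
  have "0 < root n\<^sub>t \<epsilon>" "root n\<^sub>t \<epsilon> < 1"
    using assms(4-6) by auto
  then have y: "erf y = root n\<^sub>t \<epsilon>" "0 < y" unfolding y_def by (rule erf_inv_properties)+
  have l: "0 < ?l" by (rule min_eigenvalue_gram(1)[OF assms(1)])
  define c where "c = c_est \<psi> n\<^sub>t \<epsilon>"
  have c: "c = inverse (sqrt 2 * sqrt ?l * y)"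
    by (simp add: c_def c_est_def y_def real_sqrt_mult)
  have "0 < c" using l y by (simp add: c)
  have est: "norm_estimator \<psi> Op n\<^sub>t \<epsilon> r \<omega> = c * Max ((\<lambda>i. norm (Op (?T (r i \<omega>)))) ` ?I)" for \<omega>
    by (simp add: norm_estimator_def c_def coeff_vec_inverse(1)[OF assms(1)])
  obtain b :: "real ^ 'n" where b: "onorm Op * sqrt ?l \<le> norm b"
    and bx: "\<And>x. \<bar>b \<bullet> x\<bar> \<le> norm (Op (?T x))"
    using rank_one_lower_bound[OF assms(1,3)] by blast
  let ?G = "{\<omega> \<in> space M. onorm Op \<le> norm_estimator \<psi> Op n\<^sub>t \<epsilon> r \<omega>}"
  have rv: "random_variable borel (r i)" if "i \<in> ?I" for i
    using assms(9) that unfolding indep_vars_def2 by blast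
  have "continuous_on UNIV (\<lambda>x. norm (Op (?T x)))"
    using linear_compose[OF linear_combination_linear \<open>linear Op\<close>, of \<psi>]
    by (intro continuous_on_norm linear_continuous_on)
       (simp add: linear_conv_bounded_linear o_def)
  then have "(\<lambda>x. norm (Op (?T x))) \<in> borel_measurable borel"
    by (rule borel_measurable_continuous_onI)
  then have "(\<lambda>\<omega>. norm (Op (?T (r i \<omega>)))) \<in> borel_measurable M" if "i \<in> ?I" for i
    using rv[OF that] by (rule measurable_compose[rotated])
  then have "(\<lambda>\<omega>. norm_estimator \<psi> Op n\<^sub>t \<epsilon> r \<omega>) \<in> borel_measurable M"
    unfolding est by (intro borel_measurable_times borel_measurable_const borel_measurable_Max) auto
  then have G: "?G \<in> events" by measurable
  show ?thesis
  proof (cases "b = 0")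
    case True
    \<comment> \<open>Here the operator vanishes, and the estimator is nonnegative.\<close>
    with b l have "onorm Op \<le> 0" by (simp add: mult_le_0_iff)
    moreover have "0 \<le> norm_estimator \<psi> Op n\<^sub>t \<epsilon> r \<omega>" for \<omega>
    proof -
      have "0 \<le> norm (Op (?T (r 1 \<omega>)))" by simp
      also have "\<dots> \<le> Max ((\<lambda>i. norm (Op (?T (r i \<omega>)))) ` ?I)"
        using \<open>n\<^sub>t \<ge> 1\<close> by (intro Max_ge) auto
      finally show ?thesis unfolding est using \<open>0 < c\<close> by simp
    qed
    ultimately have "onorm Op \<le> norm_estimator \<psi> Op n\<^sub>t \<epsilon> r \<omega>" for \<omega> by (rule order_trans)
    then have "?G = space M" by simp
    then show ?thesis using \<open>0 < \<epsilon>\<close> by (simp add: prob_space)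
  next
    case False
    \<comment> \<open>\<open>?F\<close> is the event that every test vector falls into the strip \<open>\<bar>b \<bullet> x\<bar> < sqrt 2 * norm b * y\<close>;
      it has probability exactly \<open>\<epsilon>\<close> and contains the failure event of the estimator.\<close>
    let ?J = "{- (sqrt 2 * norm b * y) <..< sqrt 2 * norm b * y}"
    let ?F = "\<Inter>i\<in>?I. (\<lambda>\<omega>. b \<bullet> r i \<omega>) -` ?J \<inter> space M"
    have "indep_vars (\<lambda>_. borel) (\<lambda>i \<omega>. b \<bullet> r i \<omega>) ?I"
      by (rule indep_vars_compose2[where Y="\<lambda>i x. b \<bullet> x", OF assms(9)]) auto
    then have "prob ?F = (\<Prod>i\<in>?I. prob ((\<lambda>\<omega>. b \<bullet> r i \<omega>) -` ?J \<inter> space M))"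
      by (rule indep_varsD_finite[OF _ I(2,1)]) auto
    also have "\<dots> = (\<Prod>i\<in>?I. root n\<^sub>t \<epsilon>)"
    proof (rule prod.cong[OF refl])
      fix i assume i: "i \<in> ?I"
      have "(\<lambda>\<omega>. b \<bullet> r i \<omega>) -` ?J \<inter> space M
          = {\<omega> \<in> space M. \<bar>b \<bullet> r i \<omega>\<bar> < sqrt 2 * norm b * y}"
        by (auto simp: abs_less_iff)
      then show "prob ((\<lambda>\<omega>. b \<bullet> r i \<omega>) -` ?J \<inter> space M) = root n\<^sub>t \<epsilon>"
        using prob_normal_abs_less[OF inner_random_normal_vector_distributed[OF assms(8)[OF i] False], of y]
          False y by simp
    qed
    also have "\<dots> = \<epsilon>" using assms(4,5) by (simp add: real_root_pow_pos)
    finally have F: "prob ?F = \<epsilon>" .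
    have "space M - ?G \<subseteq> ?F"
    proof
      fix \<omega> assume \<omega>: "\<omega> \<in> space M - ?G"
      have "b \<bullet> r i \<omega> \<in> ?J" if i: "i \<in> ?I" for i
      proof -
        have "c * \<bar>b \<bullet> r i \<omega>\<bar> \<le> c * Max ((\<lambda>i. norm (Op (?T (r i \<omega>)))) ` ?I)"
          using i I \<open>0 < c\<close> by (intro mult_left_mono order_trans[OF bx] Max_ge) auto
        also have "\<dots> < onorm Op" using \<omega> by (auto simp: est not_le)
        finally have "\<bar>b \<bullet> r i \<omega>\<bar> < onorm Op * sqrt ?l * (sqrt 2 * y)"
          using l y by (simp add: c field_simps)
        also have "\<dots> \<le> norm b * (sqrt 2 * y)" using b y by (intro mult_right_mono) auto
        finally show ?thesis by (simp add: abs_less_iff mult_ac)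
      qed
      with \<omega> I show "\<omega> \<in> ?F" by auto
    qed
    moreover have "?F \<in> events"
      using I rv by (intro sets.finite_INT measurable_sets[where A=borel]) auto
    ultimately have "prob (space M - ?G) \<le> prob ?F" by (rule finite_measure_mono)
    then have "prob (space M - ?G) \<le> \<epsilon>" by (simp only: F)
    then show ?thesis using prob_compl[OF G] by simp
  qed
qed

end
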